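(* Let $\mathsf{O}=(X,\mathcal{F},F)$ be an observable formulated in a commutative $C^*$-algebra $C_0(\Omega)$, where $\Omega$ is a locally compact Hausdorff space. Let $\omega_0\in\Omega$ be any fixed state, and consider the measurement $\mathsf{M}_{C_0(\Omega)}(\mathsf{O}=(X,\mathcal{F},F),S_{[\omega_0]})$ of $\mathsf{O}$ for a system with state $\omega_0$. Let $\Theta$ be a locally compact space with a semi-distance $d^x_\Theta$ for each $x\in X$. Let $\pi:\Omega\to\Theta$ be a quantity and let $E:X\to\Theta$ be an estimator. Let $\gamma$ be a real number such that $0\ll\gamma<1$, for example $\gamma=0.95$. For any state $\omega\in\Omega$, define the positive number $\eta^\gamma_\omega$ $(>0)$ by $$\eta^\gamma_\omega=\inf\{\eta>0:\ [F(\{x\in X:\ d^x_\Theta(E(x),\pi(\omega))\le\eta\})](\omega)\ge\gamma\},$$ and for any $x\in X$ define the $(\gamma)$-confidence interval of $x$ by $$D^\gamma_x=\{\pi(\omega)\in\Theta:\ \omega\in\Omega,\ d^x_\Theta(E(x),\pi(\omega))\le\eta^\gamma_\omega\}.$$ Then the probability that the measured value $x_0\in X$ obtained by the measurement $\mathsf{M}_{C_0(\Omega)}(\mathsf{O},S_{[\omega_0]})$ satisfies the condition $$D^\gamma_{x_0}\ni\pi(\omega_0)$$ is larger than $\gamma$.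
   Context: $C_0(\Omega)$ is the commutative $C^*$-algebra of continuous complex-valued functions on $\Omega$ vanishing at infinity, and $C(\Omega)$ is the $C^*$-algebra of bounded continuous complex-valued functions on $\Omega$. Elements of $\Omega$ are called states. An observable $\mathsf{O}=(X,\mathcal{F},F)$ in $C_0(\Omega)$ (precisely, in $C(\Omega)$) consists of a topological space $X$, a field $\mathcal{F}\subseteq 2^X$ (it contains $\emptyset$ and is closed under complements and finite unions), and a map $F:\mathcal{F}\to C(\Omega)$ such that for every $\omega\in\Omega$: $0\le[F(\Xi)](\omega)\le1$ for all $\Xi\in\mathcal{F}$; $[F(X)](\omega)=1$; and, whenever $\Xi_1,\Xi_2,\ldots\in\mathcal{F}$ are pairwise disjoint with $\Xi=\bigcup_{k=1}^\infty\Xi_k\in\mathcal{F}$, $[F(\Xi)](\omega)=\lim_{n\to\infty}\sum_{k=1}^n[F(\Xi_k)](\omega)$. By the Hopf extension theorem, $(X,\mathcal{F},[F(\cdot)](\omega))$ is regarded as a probability space. The measurement of $\mathsf{O}$ for a system with state $\omega_0$ is denoted $\mathsf{M}_{C_0(\Omega)}(\mathsf{O},S_{[\omega_0]})$. By axiom, the probability that the measured value $x\in X$ obtained by it belongs to a set $\Xi\in\mathcal{F}$ is $[F(\Xi)](\omega_0)$. For each $x\in X$, the semi-distance $d^x_\Theta:\Theta\times\Theta\to[0,\infty)$ satisfies $d^x_\Theta(\theta,\theta)=0$, $d^x_\Theta(\theta_1,\theta_2)=d^x_\Theta(\theta_2,\theta_1)$ and $d^x_\Theta(\theta_1,\theta_3)\le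 d^x_\Theta(\theta_1,\theta_2)+d^x_\Theta(\theta_2,\theta_3)$; it may depend on $x$. A quantity is a continuous map $\pi:\Omega\to\Theta$. An estimator is a continuous (or, more generally, measurable) map $E:X\to\Theta$.
   Formalization: "Larger than γ" is proved as "at least γ": the strict form fails, e.g. for one state, x uniform on [0,1], E the identity and π(ω)=0, where the probability is exactly γ; also the infimum η is allowed to be 0. *)

theory Defs
  imports "HOL-Analysis.Analysis" "HOL-Probability.Probability_Measure"
begin

text \<open>The algebra \<open>C(\<Omega>)\<close> is the type \<open>'w \<Rightarrow>\<^sub>C complex\<close>. Its elements are complex-valued, so
  \<open>0 \<le> F \<Xi> \<omega> \<le> 1\<close> is expressed by membership in the image of the real unit interval, and the
  real number \<open>F \<Xi> \<omega>\<close> is recovered by \<^const>\<open>Re\<close>.\<close>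

definition observable ::
  "'x set set \<Rightarrow> ('x set \<Rightarrow> ('w::topological_space \<Rightarrow>\<^sub>C complex)) \<Rightarrow> bool" where
  "observable \<F> F \<longleftrightarrow>
     algebra UNIV \<F> \<and>
     (\<forall>\<omega>. (\<forall>\<Xi>\<in>\<F>. F \<Xi> \<omega> \<in> complex_of_real ` {0..1}) \<and>
          F UNIV \<omega> = 1 \<and>
          (\<forall>A::nat \<Rightarrow> 'x set. range A \<subseteq> \<F> \<longrightarrow> disjoint_family A \<longrightarrow> (\<Union>k. A k) \<in> \<F> \<longrightarrow>
             (\<lambda>k. F (A k) \<omega>) sums F (\<Union>k. A k) \<omega>))"

text \<open>The distribution of the measured value in the state \<open>\<omega>\<close>: the extension of
  \<open>\<Xi> \<mapsto> F \<Xi> \<omega>\<close> from the field \<open>\<F>\<close> to the \<open>\<sigma>\<close>-algebra it generates.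
  The lemmas below show that it exists and is unique.\<close>

definition measurement ::
  "'x set set \<Rightarrow> ('x set \<Rightarrow> ('w::topological_space \<Rightarrow>\<^sub>C complex)) \<Rightarrow> 'w \<Rightarrow> 'x measure" where
  "measurement \<F> F \<omega> = extend_measure UNIV \<F> id (\<lambda>\<Xi>. ennreal (Re (F \<Xi> \<omega>)))"

definition semi_distance :: "('t \<Rightarrow> 't \<Rightarrow> real) \<Rightarrow> bool" where
  "semi_distance d \<longleftrightarrow>
     (\<forall>s t. 0 \<le> d s t) \<and> (\<forall>t. d t t = 0) \<and> (\<forall>s t. d s t = d t s) \<and>
     (\<forall>r s t. d r t \<le> d r s + d s t)"

definition quantity :: "('w::topological_space \<Rightarrow> 't::topological_space) \<Rightarrow> bool" where
  "quantity \<pi> \<longleftrightarrow> continuous_on UNIV \<pi>"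

text \<open>The field \<open>\<F>\<close> need not contain the open sets of \<open>X\<close>, so continuity does not imply
  measurability here and both alternatives are listed.\<close>

definition estimator ::
  "'x set set \<Rightarrow> ('x::topological_space \<Rightarrow> 't::topological_space) \<Rightarrow> bool" where
  "estimator \<F> E \<longleftrightarrow> continuous_on UNIV E \<or> E \<in> measurable (sigma UNIV \<F>) borel"

definition conf_radius ::
  "('x set \<Rightarrow> ('w::topological_space \<Rightarrow>\<^sub>C complex)) \<Rightarrow> ('x \<Rightarrow> 't \<Rightarrow> 't \<Rightarrow> real) \<Rightarrow>
   ('w \<Rightarrow> 't) \<Rightarrow> ('x \<Rightarrow> 't) \<Rightarrow> real \<Rightarrow> 'w \<Rightarrow> real" where
  "conf_radius F d \<pi> E \<gamma> \<omega> =
     Inf {\<eta>. \<eta> > 0 \<and> Re (F {x. d x (E x) (\<pi> \<omega>) \<le> \<eta>} \<omega>) \<ge> \<gamma>}"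

definition conf_interval ::
  "('x set \<Rightarrow> ('w::topological_space \<Rightarrow>\<^sub>C complex)) \<Rightarrow> ('x \<Rightarrow> 't \<Rightarrow> 't \<Rightarrow> real) \<Rightarrow>
   ('w \<Rightarrow> 't) \<Rightarrow> ('x \<Rightarrow> 't) \<Rightarrow> real \<Rightarrow> 'x \<Rightarrow> 't set" where
  "conf_interval F d \<pi> E \<gamma> x =
     {\<pi> \<omega> | \<omega>. d x (E x) (\<pi> \<omega>) \<le> conf_radius F d \<pi> E \<gamma> \<omega>}"

lemma space_measurement [simp]: "space (measurement \<F> F \<omega>) = UNIV"
  by (simp add: measurement_def space_extend_measure)

lemma sets_measurement: "sets (measurement \<F> F \<omega>) = sigma_sets UNIV \<F>"
  by (simp add: measurement_def sets_extend_measure)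

lemma emeasure_measurement:
  assumes "observable \<F> F" "\<Xi> \<in> \<F>"
  shows "emeasure (measurement \<F> F \<omega>) \<Xi> = ennreal (Re (F \<Xi> \<omega>))"
proof -
  let ?f = "\<lambda>\<Xi>. Re (F \<Xi> \<omega>)"
  interpret algebra UNIV \<F> using assms by (simp add: observable_def)
  have nonneg: "0 \<le> ?f A" if "A \<in> \<F>" for A
  proof -
    have "F A \<omega> \<in> complex_of_real ` {0..1}"
      using assms(1) that by (simp add: observable_def)
    then show ?thesis by auto
  qed
  have add: "(\<lambda>k. ?f (A k)) sums ?f (\<Union>k. A k)"
    if "range A \<subseteq> \<F>" "disjoint_family A" "(\<Union>k. A k) \<in> \<F>" for A :: "nat \<Rightarrow> 'a set"
    using sums_Re[of "\<lambda>k. F (A k) \<omega>" "F (\<Union>k. A k) \<omega>"] assms(1) that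
    by (simp add: observable_def)
  have "(\<lambda>k::nat. ?f {}) sums ?f {}"
    using add[of "\<lambda>_. {}"] by (simp add: disjoint_family_on_def)
  then have "?f {} = 0"
    using summable_const_iff[of "?f {}"] by (simp add: sums_iff)
  then have pos: "positive \<F> (\<lambda>A. ennreal (?f A))"
    by (simp add: positive_def)
  have "countably_additive \<F> (\<lambda>A. ennreal (?f A))"
    unfolding countably_additive_def
    by (intro allI impI suminf_ennreal_eq add nonneg) auto
  from caratheodory'[OF pos this] obtain \<mu> :: "'a set \<Rightarrow> ennreal"
    where \<mu>: "\<forall>A\<in>\<F>. \<mu> A = ennreal (?f A)" "measure_space UNIV (sigma_sets UNIV \<F>) \<mu>"
    by blast
  have "emeasure (measurement \<F> F \<omega>) (id \<Xi>) = ennreal (?f \<Xi>)"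
  proof (rule emeasure_extend_measure[OF measurement_def, where \<mu>' = \<mu>])
    show "positive (sets (measurement \<F> F \<omega>)) \<mu>"
      "countably_additive (sets (measurement \<F> F \<omega>)) \<mu>"
      using \<mu>(2) by (simp_all add: sets_measurement measure_space_def)
  qed (use \<mu>(1) assms(2) in simp_all)
  then show ?thesis by simp
qed

lemma prob_space_measurement:
  assumes "observable \<F> F"
  shows "prob_space (measurement \<F> F \<omega>)"
proof
  interpret algebra UNIV \<F> using assms by (simp add: observable_def)
  show "emeasure (measurement \<F> F \<omega>) (space (measurement \<F> F \<omega>)) = 1"
    using emeasure_measurement[OF assms top, of \<omega>] assms by (simp add: observable_def)
qed

lemma measurement_unique:
  assumes "observable \<F> F" "sets P = sigma_sets UNIV \<F>"
    and "\<And>\<Xi>. \<Xi> \<in> \<F> \<Longrightarrow> emeasure P \<Xi> = ennreal (Re (F \<Xi> \<omega>))"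
  shows "P = measurement \<F> F \<omega>"
proof -
  interpret algebra UNIV \<F> using assms by (simp add: observable_def)
  show ?thesis
  proof (rule measure_eqI_generator_eq[of \<F> UNIV P "measurement \<F> F \<omega>" "\<lambda>_. UNIV"])
    show "emeasure P \<Xi> = emeasure (measurement \<F> F \<omega>) \<Xi>" if "\<Xi> \<in> \<F>" for \<Xi>
      using assms(3)[OF that] emeasure_measurement[OF assms(1) that, of \<omega>] by simp
    show "emeasure P UNIV \<noteq> \<infinity>"
      using assms(3)[OF top] by simp
  qed (use assms(2) top in \<open>auto simp: Int_stable_def sets_measurement\<close>)
qed

end

theory Submission
  imports Defs "HOL-Probability.Distribution_Functions"
begin

text \<open>Fix \<open>\<omega>\<^sub>0\<close> and let \<open>g x = d x (E x) (\<pi> \<omega>\<^sub>0)\<close>. The confidence radius of \<open>\<omega>\<^sub>0\<close> is the \<open>\<gamma>\<close>-quantile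
  of \<open>g\<close>, restricted to positive values, and it is itself a point where the distribution function is at
  least \<open>\<gamma>\<close>, because distribution functions are right continuous. The confidence interval of every
  \<open>x\<close> with \<open>g x\<close> at most this radius contains \<open>\<pi> \<omega>\<^sub>0\<close>. The exact coverage event also involves all the
  states \<open>\<omega>\<close> with \<open>\<pi> \<omega> = \<pi> \<omega>\<^sub>0\<close>, possibly uncountably many with different radii; it is nevertheless
  measurable, being the preimage under \<open>g\<close> of a down-closed set of reals.\<close>

text \<open>The set is nonempty because the distribution function tends to 1 > \<gamma>. Its infimum
  may be \<open>a\<close> itself, which the set excludes; so the bound is first obtained for all
  \<open>t\<close> above the infimum, by monotonicity, and then carried over in the limit from the
  right.\<close>

lemma (in real_distribution) cdf_Inf_ge:
  assumes "\<gamma> < 1"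
  shows "\<gamma> \<le> cdf M (Inf {t. t > a \<and> \<gamma> \<le> cdf M t})"
proof -
  define T where "T = {t. t > a \<and> \<gamma> \<le> cdf M t}"
  have "\<forall>\<^sub>F t in at_top. \<gamma> < cdf M t"
    using cdf_lim_at_top_prob assms by (rule order_tendstoD(1))
  then have "\<forall>\<^sub>F t in at_top. t > a \<and> \<gamma> < cdf M t"
    using eventually_gt_at_top by (rule eventually_conj[rotated])
  then obtain t where "t > a" "\<gamma> < cdf M t"
    by (auto dest: eventually_happens'[OF trivial_limit_at_top_linorder])
  then have "T \<noteq> {}"
    by (auto simp: T_def intro: less_imp_le)
  have bdd: "bdd_below T"
    by (auto simp: T_def intro!: bdd_belowI[of _ a])
  have "\<gamma> \<le> cdf M t" if "Inf T < t" for t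
  proof -
    from that \<open>T \<noteq> {}\<close> bdd obtain s where "s \<in> T" "s < t"
      by (auto simp: cInf_less_iff)
    then show ?thesis
      using cdf_nondecreasing[of s t] by (simp add: T_def)
  qed
  then have "\<forall>\<^sub>F t in at_right (Inf T). \<gamma> \<le> cdf M t"
    by (auto simp: eventually_at_filter)
  moreover have "(cdf M \<longlongrightarrow> cdf M (Inf T)) (at_right (Inf T))"
    using cdf_is_right_cont[of "Inf T"] by (simp add: continuous_within)
  ultimately show ?thesis
    unfolding T_def[symmetric] by (intro tendsto_lowerbound) auto
qed

text \<open>The field is only known to contain sublevel sets at positive levels. Level 0 is
  recovered as the intersection over the levels \<open>1 / real (Suc n)\<close>, and negative levels
  give the empty set.\<close>

lemma borel_measurable_nonnegI_le:
  fixes g :: "'a \<Rightarrow> real"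
  assumes nonneg: "\<And>x. 0 \<le> g x"
    and le: "\<And>t. 0 < t \<Longrightarrow> {x \<in> space M. g x \<le> t} \<in> sets M"
  shows "g \<in> borel_measurable M"
  unfolding borel_measurable_iff_le
proof
  fix t :: real
  consider "t < 0" | "t = 0" | "t > 0" by linarith
  then show "{x \<in> space M. g x \<le> t} \<in> sets M"
  proof cases
    case 1
    then have "{x \<in> space M. g x \<le> t} = {}"
      using nonneg by (auto simp: not_le intro: less_le_trans)
    then show ?thesis by (simp only: sets.empty_sets)
  next
    case 2
    have "{x \<in> space M. g x \<le> t} = (\<Inter>n. {x \<in> space M. g x \<le> 1 / real (Suc n)})"
    proof (intro set_eqI iffI)
      fix x assume "x \<in> (\<Inter>n. {x \<in> space M. g x \<le> 1 / real (Suc n)})"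
      then have x: "x \<in> space M" "\<And>n. g x \<le> 1 / real (Suc n)" by auto
      have "g x \<le> 0"
        using x(2) nat_approx_posE[of "g x"] by (metis linorder_not_le)
      with x 2 show "x \<in> {x \<in> space M. g x \<le> t}" by simp
    qed (use 2 in \<open>auto intro: order_trans\<close>)
    also have "\<dots> \<in> sets M"
      by (intro sets.countable_INT) (auto intro: le)
    finally show ?thesis .
  qed (rule le)
qed

text \<open>\<open>A\<close> may be uncountable and non-measurable, but a down-closed set of reals
  is an interval.\<close>

lemma borel_down_set:
  fixes A :: "real set"
  shows "(\<Union>r\<in>A. {..r}) \<in> sets borel"
proof (rule real_interval_borel_measurable)
  show "is_interval (\<Union>r\<in>A. {..r})"
    unfolding is_interval_1
  proof (intro ballI allI impI)
    fix a b x :: real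
    assume "b \<in> (\<Union>r\<in>A. {..r})" "a \<le> x \<and> x \<le> b"
    then obtain r where "r \<in> A" "x \<le> r"
      by (blast intro: order_trans)
    then show "x \<in> (\<Union>r\<in>A. {..r})"
      by blast
  qed
qed

lemma mem_conf_interval_iff:
  "\<pi> \<omega>\<^sub>0 \<in> conf_interval F d \<pi> E \<gamma> x \<longleftrightarrow>
    (\<exists>\<omega>. \<pi> \<omega> = \<pi> \<omega>\<^sub>0 \<and> d x (E x) (\<pi> \<omega>\<^sub>0) \<le> conf_radius F d \<pi> E \<gamma> \<omega>)"
proof
  assume "\<pi> \<omega>\<^sub>0 \<in> conf_interval F d \<pi> E \<gamma> x"
  then obtain \<omega> where "\<pi> \<omega>\<^sub>0 = \<pi> \<omega>" "d x (E x) (\<pi> \<omega>) \<le> conf_radius F d \<pi> E \<gamma> \<omega>"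
    unfolding conf_interval_def by blast
  then show "\<exists>\<omega>. \<pi> \<omega> = \<pi> \<omega>\<^sub>0 \<and> d x (E x) (\<pi> \<omega>\<^sub>0) \<le> conf_radius F d \<pi> E \<gamma> \<omega>"
    by (intro exI[of _ \<omega>]) simp
next
  assume "\<exists>\<omega>. \<pi> \<omega> = \<pi> \<omega>\<^sub>0 \<and> d x (E x) (\<pi> \<omega>\<^sub>0) \<le> conf_radius F d \<pi> E \<gamma> \<omega>"
  then obtain \<omega> where "\<pi> \<omega> = \<pi> \<omega>\<^sub>0" "d x (E x) (\<pi> \<omega>\<^sub>0) \<le> conf_radius F d \<pi> E \<gamma> \<omega>"
    by blast
  then show "\<pi> \<omega>\<^sub>0 \<in> conf_interval F d \<pi> E \<gamma> x"
    unfolding conf_interval_def by (intro CollectI exI[of _ \<omega>]) simp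
qed

lemma measure_measurement:
  assumes "observable \<F> F" "\<Xi> \<in> \<F>"
  shows "measure (measurement \<F> F \<omega>) \<Xi> = Re (F \<Xi> \<omega>)"
proof -
  \<comment> \<open>\<open>ennreal\<close> sends negative reals to 0, so nonnegativity is what lets
    the real value be read back.\<close>
  have "F \<Xi> \<omega> \<in> complex_of_real ` {0..1}"
    using assms by (simp add: observable_def)
  then have "0 \<le> Re (F \<Xi> \<omega>)" by auto
  then show ?thesis
    using emeasure_measurement[OF assms, of \<omega>] by (simp add: measure_def)
qed

theorem theorem2:
  fixes \<F> :: "'x::topological_space set set"
    and F :: "'x set \<Rightarrow> ('w::t2_space \<Rightarrow>\<^sub>C complex)"
    and d :: "'x \<Rightarrow> 't::topological_space \<Rightarrow> 't \<Rightarrow> real"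
    and \<pi> :: "'w \<Rightarrow> 't"
    and E :: "'x \<Rightarrow> 't"
    and \<gamma> :: real
    and \<omega>\<^sub>0 :: 'w
  assumes "locally_compact_space (euclidean :: 'w topology)"
    and "locally_compact_space (euclidean :: 't topology)"
    and "observable \<F> F"
    and "\<And>x. semi_distance (d x)"
    and "quantity \<pi>"
    and "estimator \<F> E"
    and "\<And>\<omega> \<eta>. \<eta> > 0 \<Longrightarrow> {x. d x (E x) (\<pi> \<omega>) \<le> \<eta>} \<in> \<F>"
    and "0 < \<gamma>" "\<gamma> < 1"
  shows "{x\<^sub>0. \<pi> \<omega>\<^sub>0 \<in> conf_interval F d \<pi> E \<gamma> x\<^sub>0} \<in> sets (measurement \<F> F \<omega>\<^sub>0) \<and>
    measure (measurement \<F> F \<omega>\<^sub>0) {x\<^sub>0. \<pi> \<omega>\<^sub>0 \<in> conf_interval F d \<pi> E \<gamma> x\<^sub>0} \<ge> \<gamma>"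
proof -
  define M where "M = measurement \<F> F \<omega>\<^sub>0"
  define g where "g x = d x (E x) (\<pi> \<omega>\<^sub>0)" for x
  define r where "r \<omega> = conf_radius F d \<pi> E \<gamma> \<omega>" for \<omega>
  interpret prob_space M
    unfolding M_def by (rule prob_space_measurement) fact
  have [simp]: "space M = UNIV" by (simp add: M_def)
  have field: "{x. g x \<le> t} \<in> \<F>" if "0 < t" for t
    unfolding g_def using assms(7) that .
  have g [measurable]: "g \<in> borel_measurable M"
  proof (rule borel_measurable_nonnegI_le)
    show "0 \<le> g x" for x
      using assms(4)[of x] by (simp add: g_def semi_distance_def)
    show "{x \<in> space M. g x \<le> t} \<in> sets M" if "0 < t" for t
      using field[OF that] by (auto simp: M_def sets_measurement)
  qed
  interpret D: real_distribution "distr M borel g" by simp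
  have cdf: "cdf (distr M borel g) t = measure M {x. g x \<le> t}" for t
    by (simp add: cdf_def measure_distr vimage_def)
  \<comment> \<open>For \<open>t > 0\<close> the sublevel set lies in the field, where
    \<open>F\<close> and the extended measure agree.\<close>
  have "r \<omega>\<^sub>0 = Inf {t. t > 0 \<and> \<gamma> \<le> cdf (distr M borel g) t}"
    unfolding r_def conf_radius_def cdf g_def[symmetric]
    using field by (intro arg_cong[where f = Inf])
      (auto simp: M_def measure_measurement[OF assms(3)])
  then have "\<gamma> \<le> measure M {x. g x \<le> r \<omega>\<^sub>0}"
    using D.cdf_Inf_ge[OF assms(9)] cdf by simp
  moreover define C where "C = {x. \<pi> \<omega>\<^sub>0 \<in> conf_interval F d \<pi> E \<gamma> x}"
  \<comment> \<open>All states in the fibre of \<pi> through \<open>\<omega>\<^sub>0\<close> share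
    the distance \<open>g\<close>; only their radii differ.\<close>
  have "C = g -` (\<Union>s\<in>r ` {\<omega>. \<pi> \<omega> = \<pi> \<omega>\<^sub>0}. {..s}) \<inter> space M"
    by (auto simp: C_def g_def r_def mem_conf_interval_iff)
  then have C: "C \<in> sets M"
    by (simp only: measurable_sets[OF g borel_down_set])
  \<comment> \<open>The state \<open>\<omega>\<^sub>0\<close> itself witnesses membership in
    \<open>C\<close>.\<close>
  moreover have "measure M {x. g x \<le> r \<omega>\<^sub>0} \<le> measure M C"
    using C by (intro finite_measure_mono) (auto simp: C_def g_def r_def mem_conf_interval_iff)
  ultimately show ?thesis
    unfolding C_def M_def by linarith
qed

end
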